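(* Let $\gamma\in\operatorname{End}(V\otimes V)$ be a homogeneous operator for which the generating functions are of the form $G^\gamma_{i,j}(x)=\alpha(x)x^i+\beta(x)x^j$, where $\alpha(x),\beta(x)\in\mathbb{F}(x)$ are rational functions independent of $i$ and $j$. Then $\gamma$ satisfies the Yang-Baxter equation if and only if $\beta(x)=0$ or the following two identities hold: \begin{enumerate} \item $\alpha(x)\alpha(y)=\alpha(xy^{-1})\alpha(y)+\alpha(x)\alpha(yx^{-1})$; \item $\alpha(xy^{-1})^2\alpha(y)+\beta(xy^{-1})\alpha(x)\beta(yx^{-1})=\alpha(y)^2\alpha(xy^{-1})+\beta(y)\alpha(x)\beta(y^{-1})$. \end{enumerate}
   Context: $V$ is an $n$-dimensional vector space over a field $\mathbb{F}$ with basis $\{e_1,\dots,e_n\}$. An operator $\gamma\in\operatorname{End}(V\otimes V)$, $\gamma(e_i\otimes e_j)=\sum_{k,l}\gamma^{kl}_{ij}\,e_k\otimes e_l$, is called homogeneous if $\gamma^{kl}_{ij}\neq0$ only if $i+j=k+l$. In that case write $\gamma(i,j,k)=\gamma^{k,\,i+j-k}_{ij}$, so that $\gamma(e_i\otimes e_j)=\sum_k\gamma(i,j,k)\,e_k\otimes e_{i+j-k}$. The generating functions for the coefficients of $\gamma$ are the polynomials $G^\gamma_{i,j}(x)=\sum_k\gamma(i,j,k)x^k$, $1\le i,j\le n$. The Yang-Baxter equation is taken in its braid version: $\gamma_{12}\gamma_{23}\gamma_{12}=\gamma_{23}\gamma_{12}\gamma_{23}$ in $\operatorname{End}(V\otimes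 V\otimes V)$, where $\gamma_{12}=\gamma\otimes 1$ and $\gamma_{23}=1\otimes\gamma$. A solution is not required to be invertible.
   Formalization: The dimension n of V is assumed to be at least 2; for n = 1 the claim fails, e.g. γ = 1 with α = x, β = 1 − x satisfies Yang-Baxter while β ≠ 0 and identity (1) reads xy = x + y. *)

theory Defs
  imports "HOL-Computational_Algebra.Computational_Algebra"
begin

text \<open>
  The space \<open>V\<close> with basis \<open>e_1, ..., e_n\<close> and its tensor powers are given in coordinates:
  \<open>coord_space I\<close> is the space with basis \<open>(unit_vec x)\<close>, \<open>x \<in> I\<close>, its elements being the coordinate
  functions that vanish outside \<open>I\<close>. The basis tensor \<open>e_i \<otimes> e_j\<close> is \<open>unit_vec (i, j)\<close>, and
  \<open>e_i \<otimes> e_j \<otimes> e_k\<close> is \<open>unit_vec (i, j, k)\<close>.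
\<close>

definition coord_space :: "'i set \<Rightarrow> ('i \<Rightarrow> 'a::zero) set" where
  "coord_space I = {f. \<forall>x. x \<notin> I \<longrightarrow> f x = 0}"

definition unit_vec :: "'i \<Rightarrow> 'i \<Rightarrow> 'a::zero_neq_one" where
  "unit_vec x = (\<lambda>y. if y = x then 1 else 0)"

definition tensor2 :: "nat \<Rightarrow> (nat \<times> nat \<Rightarrow> 'a::zero) set" where
  "tensor2 n = coord_space ({1..n} \<times> {1..n})"

definition tensor3 :: "nat \<Rightarrow> (nat \<times> nat \<times> nat \<Rightarrow> 'a::zero) set" where
  "tensor3 n = coord_space ({1..n} \<times> {1..n} \<times> {1..n})"

definition endo_on :: "('i \<Rightarrow> 'a::field) set \<Rightarrow> (('i \<Rightarrow> 'a) \<Rightarrow> ('i \<Rightarrow> 'a)) \<Rightarrow> bool" where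
  "endo_on W T \<longleftrightarrow>
     (\<forall>f\<in>W. T f \<in> W) \<and>
     (\<forall>f\<in>W. \<forall>g\<in>W. T (\<lambda>x. f x + g x) = (\<lambda>x. T f x + T g x)) \<and>
     (\<forall>c. \<forall>f\<in>W. T (\<lambda>x. c * f x) = (\<lambda>x. c * T f x))"

type_synonym 'a operator2 = "(nat \<times> nat \<Rightarrow> 'a) \<Rightarrow> (nat \<times> nat \<Rightarrow> 'a)"

text \<open>\<open>matrix_coeff \<gamma> i j k l\<close> is the coefficient of \<open>e_k \<otimes> e_l\<close> in \<open>\<gamma> (e_i \<otimes> e_j)\<close>.\<close>

definition matrix_coeff :: "'a::field operator2 \<Rightarrow> nat \<Rightarrow> nat \<Rightarrow> nat \<Rightarrow> nat \<Rightarrow> 'a" where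
  "matrix_coeff \<gamma> i j k l = \<gamma> (unit_vec (i, j)) (k, l)"

definition homogeneous :: "nat \<Rightarrow> 'a::field operator2 \<Rightarrow> bool" where
  "homogeneous n \<gamma> \<longleftrightarrow>
     (\<forall>i\<in>{1..n}. \<forall>j\<in>{1..n}. \<forall>k\<in>{1..n}. \<forall>l\<in>{1..n}.
        matrix_coeff \<gamma> i j k l \<noteq> 0 \<longrightarrow> i + j = k + l)"

text \<open>
  If \<open>k \<ge> i + j\<close>, the truncated difference \<open>i + j - k\<close> is \<open>0\<close>, which is not an index of a basis
  vector, so the coefficient below is \<open>0\<close> for an endomorphism of \<open>tensor2 n\<close>; likewise when
  \<open>i + j - k > n\<close>.
\<close>

definition hom_coeff :: "'a::field operator2 \<Rightarrow> nat \<Rightarrow> nat \<Rightarrow> nat \<Rightarrow> 'a" where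
  "hom_coeff \<gamma> i j k = matrix_coeff \<gamma> i j k (i + j - k)"

definition gen_fun :: "nat \<Rightarrow> 'a::field operator2 \<Rightarrow> nat \<Rightarrow> nat \<Rightarrow> 'a poly" where
  "gen_fun n \<gamma> i j = (\<Sum>k=1..n. monom (hom_coeff \<gamma> i j k) k)"

text \<open>
  \<open>\<gamma> \<otimes> 1\<close> and \<open>1 \<otimes> \<gamma>\<close> apply \<open>\<gamma>\<close> to the slices of a 3-tensor in which the third, respectively
  the first, index is fixed.
\<close>

definition op12 :: "'a::field operator2 \<Rightarrow> (nat \<times> nat \<times> nat \<Rightarrow> 'a) \<Rightarrow> (nat \<times> nat \<times> nat \<Rightarrow> 'a)" where
  "op12 \<gamma> f = (\<lambda>(a, b, c). \<gamma> (\<lambda>(i, j). f (i, j, c)) (a, b))"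

definition op23 :: "'a::field operator2 \<Rightarrow> (nat \<times> nat \<times> nat \<Rightarrow> 'a) \<Rightarrow> (nat \<times> nat \<times> nat \<Rightarrow> 'a)" where
  "op23 \<gamma> f = (\<lambda>(a, b, c). \<gamma> (\<lambda>(j, k). f (a, j, k)) (b, c))"

definition yang_baxter :: "nat \<Rightarrow> 'a::field operator2 \<Rightarrow> bool" where
  "yang_baxter n \<gamma> \<longleftrightarrow>
     (\<forall>f\<in>tensor3 n. op12 \<gamma> (op23 \<gamma> (op12 \<gamma> f)) = op23 \<gamma> (op12 \<gamma> (op23 \<gamma> f)))"

text \<open>
  The field \<open>F(x)\<close> is \<open>'a poly fract\<close>, and \<open>F(x,y)\<close> is the fraction field \<open>'a poly poly fract\<close> of
  \<open>F[x][y]\<close>.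
\<close>

definition ratX :: "'a::field poly fract" where
  "ratX = to_fract [:0, 1:]"

definition bivX :: "'a::field poly poly fract" where
  "bivX = to_fract [:[:0, 1:]:]"

definition bivY :: "'a::field poly poly fract" where
  "bivY = to_fract [:0, 1:]"

definition poly_at :: "'a::field poly \<Rightarrow> 'a poly poly fract \<Rightarrow> 'a poly poly fract" where
  "poly_at p t = poly (map_poly (\<lambda>c. to_fract [:[:c:]:]) p) t"

text \<open>
  Substitution of \<open>t \<in> F(x,y)\<close> into a rational function \<open>r = p/q \<in> F(x)\<close>. The representation of
  \<open>r\<close> is irrelevant as long as \<open>q(t) \<noteq> 0\<close> (lemma \<open>subst_rat_eq\<close>), and for \<open>t\<close> transcendental over
  \<open>F\<close>, such as \<open>x\<close>, \<open>y\<close>, \<open>x/y\<close>, \<open>y/x\<close> and \<open>1/y\<close>, this holds for every \<open>q \<noteq> 0\<close>.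
\<close>

definition subst_rat :: "'a::field poly fract \<Rightarrow> 'a poly poly fract \<Rightarrow> 'a poly poly fract" where
  "subst_rat r t = (THE v. \<exists>p q. r = to_fract p / to_fract q \<and> poly_at q t \<noteq> 0 \<and>
                               v = poly_at p t / poly_at q t)"

lemma poly_at_0 [simp]: "poly_at 0 t = 0"
  by (simp add: poly_at_def)

lemma poly_at_pCons: "poly_at (pCons c p) t = to_fract [:[:c:]:] + t * poly_at p t"
  by (cases "p = 0 \<and> c = 0") (auto simp: poly_at_def map_poly_pCons)

lemma poly_at_add: "poly_at (p + q) t = poly_at p t + poly_at q t"
proof (induction p arbitrary: q)
  case (pCons c p)
  obtain d q' where q: "q = pCons d q'" by (cases q)
  have "to_fract [:[:c + d:]:] = to_fract [:[:c:]:] + to_fract [:[:d:]:]"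
    by (simp flip: to_fract_add)
  then show ?case using pCons.IH[of q'] by (simp add: q poly_at_pCons algebra_simps)
qed simp

lemma poly_at_smult: "poly_at (smult c p) t = to_fract [:[:c:]:] * poly_at p t"
proof (induction p)
  case (pCons d p)
  have "to_fract [:[:c * d:]:] = to_fract [:[:c:]:] * to_fract [:[:d:]:]"
    by (simp flip: to_fract_mult)
  then show ?case using pCons.IH by (simp add: poly_at_pCons algebra_simps)
qed simp

lemma poly_at_mult: "poly_at (p * q) t = poly_at p t * poly_at q t"
proof (induction p)
  case (pCons c p)
  then show ?case
    by (simp add: poly_at_add poly_at_smult poly_at_pCons algebra_simps)
qed simp

lemma subst_rat_eq:
  assumes "poly_at q t \<noteq> 0"
  shows "subst_rat (to_fract p / to_fract q) t = poly_at p t / poly_at q t"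
  unfolding subst_rat_def
proof (rule the_equality)
  fix v
  assume "\<exists>p' q'. to_fract p / to_fract q = to_fract p' / to_fract q' \<and> poly_at q' t \<noteq> 0 \<and>
            v = poly_at p' t / poly_at q' t"
  then obtain p' q' where eq: "to_fract p / to_fract q = to_fract p' / to_fract q'"
    and q': "poly_at q' t \<noteq> 0" and v: "v = poly_at p' t / poly_at q' t" by blast
  have "q \<noteq> 0" "q' \<noteq> 0" using assms q' by auto
  then have "to_fract (p * q') = to_fract (p' * q)"
    using eq by (simp add: frac_eq_eq)
  then have "p * q' = p' * q" by (simp only: to_fract_eq_iff)
  then have "poly_at p t * poly_at q' t = poly_at p' t * poly_at q t"
    by (metis poly_at_mult)
  then show "v = poly_at p t / poly_at q t"
    using assms q' v by (simp add: frac_eq_eq)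
qed (use assms in blast)

end

theory Submission
  imports Defs
begin

text \<open>
  The generating function \<open>G_{11}\<close> is a multiple of \<open>x\<close>, and \<open>G_{21}\<close> is a combination of \<open>x\<close> and \<open>x\<^sup>2\<close>,
  because the indices of \<open>e_k \<otimes> e_l\<close> are positive and add up to \<open>2\<close> and to \<open>3\<close>. This alone determines
  the shape of the rational functions: there are scalars \<open>a, b, c\<close> with
  \<open>\<alpha> = (a x + b) / (x - 1)\<close> and \<open>\<alpha> + \<beta> = c\<close> (lemma \<open>generating_function_shape\<close>).

  Identify \<open>e_i \<otimes> e_j\<close> with the monomial \<open>x\<^sup>i y\<^sup>j\<close>. Since
  \<open>\<gamma> (x\<^sup>i y\<^sup>j) = y ^ (i + j) * G_{ij} (x / y)\<close>, the operator becomes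
  \<open>(\<gamma> f)(x, y) = A(x, y) f(x, y) + (c - A(x, y)) f(y, x)\<close>, where
  \<open>A(x, y) = \<alpha>(x / y) = (a x + b y) / (x - y)\<close>: an operator of Demazure-Lusztig type.
  On functions of three variables, \<open>T_1 = \<gamma> \<otimes> 1\<close> and \<open>T_2 = 1 \<otimes> \<gamma>\<close> are such operators in the first
  and in the last two variables. Expanding the two sides of the braid relation over the permutations
  of the variables, all differences of coefficients are multiples of
  \<open>A(x, y) A(y, z) + A(x, z) A(y, x) - A(y, z) A(x, z)\<close>, which equals \<open>- a b\<close>
  (lemma \<open>wt_cocycle\<close>), and the multipliers are the coefficients of \<open>T_1 - T_2\<close>. Hence
  \<open>T_1 T_2 T_1 - T_2 T_1 T_2 = - a b (T_1 - T_2)\<close> (lemma \<open>braid_defect\<close>).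

  So the Yang-Baxter equation holds iff \<open>a b = 0\<close> or \<open>T_1 = T_2\<close>. The latter means that \<open>\<gamma>\<close> is the
  scalar \<open>c\<close>, i.e. \<open>a = c\<close>, \<open>b = - c\<close>, i.e. \<open>\<beta> = 0\<close>. On the other side, with \<open>z = 1\<close> the cocycle
  relation says that the first of the two identities holds iff \<open>a b = 0\<close>, and the two sides of the
  second identity differ by a multiple of \<open>a b\<close> as well (lemma \<open>wt_second_identity\<close>), so that the second
  identity follows from the first.
\<close>

section \<open>Twisted swaps and the defect of the braid relation\<close>

text \<open>
  The homogeneous form \<open>A(x, y)\<close> of \<open>\<alpha>(t) = (a t + b) / (t - 1)\<close>: it is \<open>\<alpha>(x / y)\<close>, and
  \<open>\<alpha>(x)\<close> is the value at \<open>(x, 1)\<close>.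
\<close>

definition wt :: "'k::field \<Rightarrow> 'k \<Rightarrow> 'k \<Rightarrow> 'k \<Rightarrow> 'k" where
  "wt a b x y = (a * x + b * y) / (x - y)"

lemma wt_swap:
  assumes "x \<noteq> y"
  shows "wt a b y x = a - b - wt a b x y"
proof -
  have "x - y \<noteq> 0" "y - x \<noteq> 0" using assms by auto
  then show ?thesis unfolding wt_def by (simp add: divide_simps) (simp add: algebra_simps)
qed

text \<open>
  For \<open>z = 1\<close> this is the first identity of the theorem, with the obstruction \<open>a b\<close>. The difference of
  the two sides has no poles because the residues along \<open>x = y\<close>, \<open>x = z\<close> and \<open>y = z\<close> cancel, and it is
  homogeneous of degree \<open>0\<close>, so it must be a constant.
\<close>

lemma wt_cocycle:
  assumes "x \<noteq> y" "x \<noteq> z" "y \<noteq> z"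
  shows "wt a b x y * wt a b y z + wt a b x z * wt a b y x = wt a b y z * wt a b x z - a * b"
proof -
  have "x - y \<noteq> 0" "y - x \<noteq> 0" "x - z \<noteq> 0" "y - z \<noteq> 0" using assms by auto
  then show ?thesis unfolding wt_def by (simp add: divide_simps) (simp add: algebra_simps)
qed

lemma wt_quotient:
  assumes "y \<noteq> 0"
  shows "wt a b (x / y) 1 = wt a b x y"
proof (cases "x = y")
  case False
  then have "x - y \<noteq> 0" by simp
  then show ?thesis using assms by (simp add: wt_def divide_simps)
qed (simp add: wt_def assms)

text \<open>
  By \<open>wt_swap\<close>, \<open>(c - A(x, y)) (c - A(y, x))\<close> is a quadratic polynomial in \<open>A(x, y)\<close>, and likewise
  for \<open>y, z\<close>. The difference therefore contains the factor \<open>A(x, y) - A(y, z)\<close>, and the cofactor is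
  the combination evaluated by \<open>wt_cocycle\<close>; \<open>c\<close> cancels. For \<open>z = 1\<close> this is the second identity of
  the theorem.
\<close>

lemma wt_second_identity:
  assumes "x \<noteq> y" "x \<noteq> z" "y \<noteq> z"
  shows "(wt a b x y)\<^sup>2 * wt a b y z + (c - wt a b x y) * wt a b x z * (c - wt a b y x)
       - ((wt a b y z)\<^sup>2 * wt a b x y + (c - wt a b y z) * wt a b x z * (c - wt a b z y))
       = - (a * b) * (wt a b x y - wt a b y z)"
  using wt_cocycle[OF assms, of a b] wt_swap[OF assms(1), of a b] wt_swap[OF assms(3), of a b]
  by algebra

text \<open>
  In both triple products the coefficients of \<open>h y z x\<close>, \<open>h z x y\<close> and \<open>h z y x\<close> agree. Those of
  \<open>h y x z\<close> and \<open>h x z y\<close> differ by a multiple of the cocycle relation, and that of \<open>h x y z\<close> by the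
  second identity. What remains is \<open>- a b\<close> times the coefficients of \<open>S1 h - S2 h\<close>.
\<close>

lemma twisted_braid_defect:
  fixes h :: "'k::field \<Rightarrow> 'k \<Rightarrow> 'k \<Rightarrow> 'k" and a b c :: 'k
  assumes "x \<noteq> y" "x \<noteq> z" "y \<noteq> z"
  defines "S1 \<equiv> \<lambda>h x y z. wt a b x y * h x y z + (c - wt a b x y) * h y x z"
    and "S2 \<equiv> \<lambda>h x y z. wt a b y z * h x y z + (c - wt a b y z) * h x z y"
  shows "S1 (S2 (S1 h)) x y z - S2 (S1 (S2 h)) x y z = - (a * b) * (S1 h x y z - S2 h x y z)"
proof -
  define E where "E = wt a b x y * wt a b y z + wt a b x z * wt a b y x
      - wt a b y z * wt a b x z + a * b"
  have "S1 (S2 (S1 h)) x y z - S2 (S1 (S2 h)) x y z + a * b * (S1 h x y z - S2 h x y z)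
      = E * ((wt a b x y - wt a b y z) * h x y z + (c - wt a b x y) * h y x z
          - (c - wt a b y z) * h x z y)"
    unfolding S1_def S2_def E_def wt_swap[OF assms(1)] wt_swap[OF assms(3)] by algebra
  moreover have "E = 0"
    using wt_cocycle[OF assms(1-3), of a b] by (simp add: E_def)
  ultimately show ?thesis by (simp add: add_eq_0_iff)
qed

section \<open>Tensors as functions\<close>

definition emb :: "'a::field \<Rightarrow> 'a poly poly fract" where
  "emb c = to_fract [:[:c:]:]"

lemma emb_0 [simp]: "emb 0 = 0"
  and emb_1 [simp]: "emb 1 = 1"
  and emb_add: "emb (c + d) = emb c + emb d"
  and emb_diff: "emb (c - d) = emb c - emb d"
  and emb_mult: "emb (c * d) = emb c * emb d"
  and emb_eq_0_iff [simp]: "emb c = 0 \<longleftrightarrow> c = 0"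
  by (simp_all add: emb_def flip: to_fract_add to_fract_diff to_fract_mult one_pCons)

lemma emb_minus: "emb (- c) = - emb c"
  using emb_diff[of 0 c] by simp

lemma emb_sum: "emb (sum f S) = (\<Sum>x\<in>S. emb (f x))"
  by (induction S rule: infinite_finite_induct) (simp_all add: emb_add)

lemma poly_at_linear: "poly_at [:b, a:] t = emb a * t + emb b"
  by (simp add: poly_at_pCons emb_def mult.commute)

lemma poly_at_monom: "poly_at (monom c k) t = emb c * t ^ k"
  by (induction k) (simp_all add: monom_0 monom_Suc poly_at_pCons emb_def del: pCons_0_0)

lemma poly_at_sum: "poly_at (sum f S) t = (\<Sum>x\<in>S. poly_at (f x) t)"
  by (induction S rule: infinite_finite_induct) (simp_all add: poly_at_add)

text \<open>
  A tensor is the list of coefficients of a polynomial, \<open>e_i \<otimes> e_j\<close> being \<open>x\<^sup>i y\<^sup>j\<close>. The polynomial is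
  represented by its values at points of \<open>F(x, y)\<close>, so that permuting the variables means permuting
  the arguments and division by \<open>x - y\<close> is available.
\<close>

definition ev2 :: "nat \<Rightarrow> (nat \<times> nat \<Rightarrow> 'a::field) \<Rightarrow> 'a poly poly fract \<Rightarrow> 'a poly poly fract
    \<Rightarrow> 'a poly poly fract" where
  "ev2 n f x y = (\<Sum>i=1..n. \<Sum>j=1..n. emb (f (i, j)) * x ^ i * y ^ j)"

definition ev3 :: "nat \<Rightarrow> (nat \<times> nat \<times> nat \<Rightarrow> 'a::field) \<Rightarrow> 'a poly poly fract
    \<Rightarrow> 'a poly poly fract \<Rightarrow> 'a poly poly fract \<Rightarrow> 'a poly poly fract" where
  "ev3 n f x y z = (\<Sum>i=1..n. \<Sum>j=1..n. \<Sum>k=1..n. emb (f (i, j, k)) * x ^ i * y ^ j * z ^ k)"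

lemma ev2_pairs: "ev2 n f x y = (\<Sum>p\<in>{1..n} \<times> {1..n}. emb (f p) * x ^ fst p * y ^ snd p)"
  by (simp add: ev2_def sum.cartesian_product case_prod_unfold)

lemma ev3_slice_last: "ev3 n f x y z = (\<Sum>k=1..n. ev2 n (\<lambda>(i, j). f (i, j, k)) x y * z ^ k)"
proof -
  have "ev3 n f x y z
      = (\<Sum>i=1..n. \<Sum>k=1..n. \<Sum>j=1..n. emb (f (i, j, k)) * x ^ i * y ^ j * z ^ k)"
    unfolding ev3_def by (intro sum.cong refl sum.swap)
  also have "\<dots> = (\<Sum>k=1..n. \<Sum>i=1..n. \<Sum>j=1..n. emb (f (i, j, k)) * x ^ i * y ^ j * z ^ k)"
    by (rule sum.swap)
  finally show ?thesis by (simp add: ev2_def sum_distrib_right)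
qed

lemma ev3_slice_first: "ev3 n f x y z = (\<Sum>i=1..n. x ^ i * ev2 n (\<lambda>(j, k). f (i, j, k)) y z)"
  by (simp add: ev3_def ev2_def sum_distrib_left mult_ac)

lemma ev3_diff: "ev3 n (\<lambda>t. f t - g t) x y z = ev3 n f x y z - ev3 n g x y z"
  by (simp add: ev3_def emb_diff sum_subtractf algebra_simps)

text \<open>
  One point suffices to recognise a tensor: by Kronecker substitution, the three exponents can be read
  off from those of \<open>bivX ^ i * bivY ^ (j + (n + 1) * k)\<close>, since \<open>j \<le> n\<close> makes \<open>j\<close> and \<open>k\<close> the remainder and the
  quotient modulo \<open>n + 1\<close>. Over a finite \<open>F\<close>, values at scalars would not separate tensors.
\<close>

lemma ev3_kronecker_eq_0:
  assumes "f \<in> tensor3 n" "ev3 n f bivX bivY (bivY ^ Suc n) = 0"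
  shows "f t = 0"
proof (cases "t \<in> {1..n} \<times> {1..n} \<times> {1..n}")
  case True
  then obtain i j k where t: "t = (i, j, k)" and ijk: "i \<in> {1..n}" "j \<in> {1..n}" "k \<in> {1..n}"
    by auto
  define P where "P = (\<Sum>i=1..n. \<Sum>j=1..n. \<Sum>k=1..n. monom (monom (f (i, j, k)) i) (j + Suc n * k))"
  have term_eq: "emb c * bivX ^ i * bivY ^ j * (bivY ^ Suc n) ^ k
      = to_fract (monom (monom c i) (j + Suc n * k))" for c :: 'a and i j k
  proof -
    have "monom (monom c i) (j + Suc n * k)
        = [:[:c:]:] * [:[:0, 1:]:] ^ i * [:0, 1:] ^ j * ([:0, 1:] ^ Suc n) ^ k"
    proof -
      have "[:[:c:]:] * [:[:0, 1:]:] ^ i = [:monom c i:]"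
        by (induction i) (simp_all add: monom_0 monom_Suc mult_ac)
      moreover have "[:d:] * [:0, 1:] ^ j * ([:0, 1:] ^ Suc n) ^ k = monom d (j + Suc n * k)"
        for d :: "'a poly"
        by (simp add: monom_altdef power_add power_mult del: power_Suc mult_Suc)
      ultimately show ?thesis by simp
    qed
    moreover have "to_fract (p ^ m) = to_fract p ^ m" for p :: "'a poly poly" and m
      by (induction m) simp_all
    ultimately show ?thesis
      by (simp only: emb_def bivX_def bivY_def to_fract_mult)
  qed
  have to_fract_sum: "to_fract (sum g S) = (\<Sum>x\<in>S. to_fract (g x))"
    for g :: "nat \<Rightarrow> 'a poly poly" and S
    by (induction S rule: infinite_finite_induct) simp_all
  have "to_fract P = ev3 n f bivX bivY (bivY ^ Suc n)"
    unfolding P_def ev3_def by (simp only: term_eq to_fract_sum)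
  then have "P = 0" using assms(2) by simp
  then have "0 = coeff (coeff P (j + Suc n * k)) i" by simp
  also have "\<dots> = (\<Sum>i'=1..n. \<Sum>j'=1..n. \<Sum>k'=1..n.
      if i' = i \<and> j' + Suc n * k' = j + Suc n * k then f (i', j', k') else 0)"
    unfolding P_def coeff_sum by (intro sum.cong refl) simp
  \<comment> \<open>The conditions are nested so that each sum, from the innermost one, collapses to one term.\<close>
  also have "\<dots> = (\<Sum>i'=1..n. \<Sum>j'=1..n. \<Sum>k'=1..n.
      if k' = k then if j' = j then if i' = i then f (i', j', k') else 0 else 0 else 0)"
  proof (intro sum.cong refl)
    fix i' j' k' assume "j' \<in> {1..n}"
    have "j' + Suc n * k' = j + Suc n * k \<longleftrightarrow> j' = j \<and> k' = k"
    proof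
      assume eq: "j' + Suc n * k' = j + Suc n * k"
      have "(j' + Suc n * k') mod Suc n = j'" "(j + Suc n * k) mod Suc n = j"
        using \<open>j' \<in> {1..n}\<close> ijk(2) by (simp_all del: mult_Suc)
      with eq have "j' = j" by presburger
      with eq have "Suc n * k' = Suc n * k" by linarith
      with \<open>j' = j\<close> show "j' = j \<and> k' = k" by (simp del: mult_Suc)
    qed simp
    then show "(if i' = i \<and> j' + Suc n * k' = j + Suc n * k then f (i', j', k') else 0)
      = (if k' = k then if j' = j then if i' = i then f (i', j', k') else 0 else 0 else 0)"
      by simp
  qed
  also have "\<dots> = f (i, j, k)"
    using ijk by (simp add: sum.delta)
  finally show ?thesis using t by simp
next
  case False
  then show ?thesis using assms(1) unfolding tensor3_def coord_space_def by blast
qed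

lemma bivY_power: "bivY ^ m = to_fract (monom 1 m)"
  by (induction m)
    (simp_all add: bivY_def monom_Suc monom_0 flip: one_pCons to_fract_mult)

lemma biv_distinct:
  "(bivX :: 'a::field poly poly fract) \<noteq> 0" "(bivY :: 'a poly poly fract) \<noteq> 0"
  "(bivX :: 'a poly poly fract) \<noteq> 1" "(bivY :: 'a poly poly fract) \<noteq> 1"
  by (simp_all add: bivX_def bivY_def one_pCons flip: to_fract_1)

lemma bivX_neq_bivY_power:
  assumes "m > 0"
  shows "(bivX :: 'a::field poly poly fract) \<noteq> bivY ^ m"
proof
  assume "(bivX :: 'a poly poly fract) = bivY ^ m"
  then have "[:[:0, 1 :: 'a:]:] = monom 1 m"
    by (simp add: bivX_def bivY_power)
  from arg_cong[OF this, of "\<lambda>p. coeff p 0"] show False using assms by simp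
qed

lemma bivY_neq_bivY_power:
  assumes "m \<noteq> 1"
  shows "(bivY :: 'a::field poly poly fract) \<noteq> bivY ^ m"
proof
  assume "(bivY :: 'a poly poly fract) = bivY ^ m"
  then have "to_fract (monom 1 1 :: 'a poly poly) = to_fract (monom 1 m)"
    unfolding bivY_power[symmetric] by simp
  then have "(monom 1 1 :: 'a poly poly) = monom 1 m"
    by (simp only: to_fract_eq_iff)
  from arg_cong[OF this, of degree] show False using assms by (simp add: degree_monom_eq)
qed

text \<open>
  The coordinates of the point are distinct and nonzero, so every denominator that occurs in the triple
  products is nonzero there and at its permutations.
\<close>

lemma kronecker_point:
  assumes "n > 0"
  shows "(bivX :: 'a::field poly poly fract) \<noteq> bivY"
    "(bivX :: 'a poly poly fract) \<noteq> bivY ^ Suc n"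
    "(bivY :: 'a poly poly fract) \<noteq> bivY ^ Suc n"
    "(bivX :: 'a poly poly fract) \<noteq> 0" "(bivY :: 'a poly poly fract) \<noteq> 0"
    "(bivY :: 'a poly poly fract) ^ Suc n \<noteq> 0"
  using biv_distinct(1,2) bivX_neq_bivY_power[of 1] bivX_neq_bivY_power[of "Suc n"]
    bivY_neq_bivY_power[of "Suc n"] assms
  by (simp_all del: power_Suc)

section \<open>Homogeneous operators\<close>

lemma endo_on_add:
  "endo_on W T \<Longrightarrow> f \<in> W \<Longrightarrow> g \<in> W \<Longrightarrow> T (\<lambda>x. f x + g x) = (\<lambda>x. T f x + T g x)"
  by (simp add: endo_on_def)

lemma endo_on_scale:
  "endo_on W T \<Longrightarrow> f \<in> W \<Longrightarrow> T (\<lambda>x. c * f x) = (\<lambda>x. c * T f x)"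
  by (simp add: endo_on_def)

lemma endo_on_zero:
  assumes "endo_on (coord_space I) T"
  shows "T (\<lambda>_. 0) = (\<lambda>_. 0)"
  using endo_on_scale[OF assms, of "\<lambda>_. 0" 0] by (simp add: coord_space_def)

lemma endo_on_sum:
  assumes "endo_on (coord_space I) T" "finite S" "\<And>x. x \<in> S \<Longrightarrow> h x \<in> coord_space I"
  shows "T (\<lambda>t. \<Sum>x\<in>S. c x * h x t) = (\<lambda>t. \<Sum>x\<in>S. c x * T (h x) t)"
  using assms(2,3)
proof (induction S rule: finite_induct)
  case empty
  show ?case using endo_on_zero[OF assms(1)] by simp
next
  case (insert x S)
  have "(\<lambda>t. c x * h x t) \<in> coord_space I" "(\<lambda>t. \<Sum>x\<in>S. c x * h x t) \<in> coord_space I"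
    using insert.prems by (auto simp: coord_space_def intro!: sum.neutral)
  from endo_on_add[OF assms(1) this] endo_on_scale[OF assms(1), of "h x" "c x"]
  show ?case using insert by simp
qed

lemma endo_on_expand:
  assumes "endo_on (coord_space I) T" "finite I" "g \<in> coord_space I"
  shows "T g t = (\<Sum>x\<in>I. g x * T (unit_vec x) t)"
proof -
  have "g = (\<lambda>t. \<Sum>x\<in>I. g x * unit_vec x t)"
  proof
    fix t
    show "g t = (\<Sum>x\<in>I. g x * unit_vec x t)"
      using assms(2,3) by (auto simp: unit_vec_def coord_space_def if_distrib cong: if_cong)
  qed
  moreover have "T (\<lambda>t. \<Sum>x\<in>I. g x * unit_vec x t) = (\<lambda>t. \<Sum>x\<in>I. g x * T (unit_vec x) t)"
    by (rule endo_on_sum[OF assms(1,2)]) (auto simp: coord_space_def unit_vec_def)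
  ultimately show ?thesis by metis
qed

locale homogeneous_operator =
  fixes n :: nat and \<gamma> :: "'a::field operator2"
  assumes endo: "endo_on (tensor2 n) \<gamma>"
    and hom: "homogeneous n \<gamma>"
begin

lemma endo_coord: "endo_on (coord_space ({1..n} \<times> {1..n})) \<gamma>"
  using endo by (simp add: tensor2_def)

lemma maps_tensor2: "g \<in> tensor2 n \<Longrightarrow> \<gamma> g \<in> tensor2 n"
  using endo by (simp add: endo_on_def)

lemma matrix_coeff_outside:
  assumes "i \<in> {1..n}" "j \<in> {1..n}" "(k, l) \<notin> {1..n} \<times> {1..n}"
  shows "matrix_coeff \<gamma> i j k l = 0"
proof -
  have "unit_vec (i, j) \<in> tensor2 n"
    using assms by (auto simp: tensor2_def coord_space_def unit_vec_def)
  from maps_tensor2[OF this] show ?thesis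
    using assms(3) by (simp add: tensor2_def coord_space_def matrix_coeff_def)
qed

lemma hom_coeff_eq_0:
  assumes "i \<in> {1..n}" "j \<in> {1..n}" "k \<ge> i + j"
  shows "hom_coeff \<gamma> i j k = 0"
  unfolding hom_coeff_def using assms by (intro matrix_coeff_outside) auto

lemma op12_tensor3: "f \<in> tensor3 n \<Longrightarrow> op12 \<gamma> f \<in> tensor3 n"
proof -
  assume f: "f \<in> tensor3 n"
  have sl: "(\<lambda>(i, j). f (i, j, k)) \<in> tensor2 n" for k
    using f by (auto simp: tensor3_def tensor2_def coord_space_def)
  have z: "\<gamma> (\<lambda>(i, j). f (i, j, k)) (i', j') = 0" if "k \<notin> {1..n}" for k i' j'
  proof -
    have "(\<lambda>(i, j). f (i, j, k)) = (\<lambda>_. 0)"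
      using that f by (auto simp: tensor3_def coord_space_def)
    then show ?thesis using endo_on_zero[OF endo_coord] by simp
  qed
  show ?thesis
    using maps_tensor2[OF sl] z by (fastforce simp: op12_def tensor3_def tensor2_def coord_space_def)
qed

lemma op23_tensor3: "f \<in> tensor3 n \<Longrightarrow> op23 \<gamma> f \<in> tensor3 n"
proof -
  assume f: "f \<in> tensor3 n"
  have sl: "(\<lambda>(j, k). f (i, j, k)) \<in> tensor2 n" for i
    using f by (auto simp: tensor3_def tensor2_def coord_space_def)
  have z: "\<gamma> (\<lambda>(j, k). f (i, j, k)) (j', k') = 0" if "i \<notin> {1..n}" for i j' k'
  proof -
    have "(\<lambda>(j, k). f (i, j, k)) = (\<lambda>_. 0)"
      using that f by (auto simp: tensor3_def coord_space_def)
    then show ?thesis using endo_on_zero[OF endo_coord] by simp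
  qed
  show ?thesis
    using maps_tensor2[OF sl] z by (fastforce simp: op23_def tensor3_def tensor2_def coord_space_def)
qed

text \<open>
  Homogeneity makes the image of \<open>x\<^sup>i y\<^sup>j\<close> a form of degree \<open>i + j\<close>, which is recovered from its
  dehomogenization, the generating function.
\<close>

lemma ev2_basis:
  assumes ij: "i \<in> {1..n}" "j \<in> {1..n}" and "y \<noteq> 0"
  shows "ev2 n (\<gamma> (unit_vec (i, j))) x y = y ^ (i + j) * poly_at (gen_fun n \<gamma> i j) (x / y)"
proof -
  have "(\<Sum>l=1..n. emb (\<gamma> (unit_vec (i, j)) (k, l)) * x ^ k * y ^ l)
      = y ^ (i + j) * (emb (hom_coeff \<gamma> i j k) * (x / y) ^ k)" if k: "k \<in> {1..n}" for k
  proof -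
    have supp: "\<gamma> (unit_vec (i, j)) (k, l) = (if l = i + j - k then hom_coeff \<gamma> i j k else 0)"
      if "l \<in> {1..n}" for l
    proof (cases "l = i + j - k")
      case True
      then show ?thesis by (simp add: hom_coeff_def matrix_coeff_def)
    next
      case False
      then have "i + j \<noteq> k + l" by auto
      then have "matrix_coeff \<gamma> i j k l = 0"
        using hom ij k that unfolding homogeneous_def by blast
      then show ?thesis using False by (simp add: matrix_coeff_def)
    qed
    have "(\<Sum>l=1..n. emb (\<gamma> (unit_vec (i, j)) (k, l)) * x ^ k * y ^ l)
        = (\<Sum>l=1..n. if l = i + j - k then emb (hom_coeff \<gamma> i j k) * x ^ k * y ^ l else 0)"
      by (rule sum.cong) (simp_all add: supp)
    also have "\<dots> = emb (hom_coeff \<gamma> i j k) * x ^ k * y ^ (i + j - k)"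
    proof (cases "i + j - k \<in> {1..n}")
      case False
      then have "hom_coeff \<gamma> i j k = 0"
        unfolding hom_coeff_def using ij by (intro matrix_coeff_outside) auto
      then show ?thesis by simp
    qed simp
    also have "\<dots> = y ^ (i + j) * (emb (hom_coeff \<gamma> i j k) * (x / y) ^ k)"
    proof (cases "k \<le> i + j")
      case True
      then show ?thesis using \<open>y \<noteq> 0\<close> by (simp add: power_diff power_divide)
    next
      case False
      then show ?thesis using hom_coeff_eq_0[OF ij, of k] by simp
    qed
    finally show ?thesis .
  qed
  then show ?thesis
    by (simp add: ev2_def gen_fun_def poly_at_sum poly_at_monom sum_distrib_left)
qed

end

text \<open>
  The assumption is \<open>G_{ij} = \<alpha> x\<^sup>i + (c - \<alpha>) x\<^sup>j\<close> with \<open>\<alpha> = (a x + b) / (x - 1)\<close>, multiplied by the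
  denominator so that it can be stated, and evaluated, in \<open>F[x]\<close>.
\<close>

locale rational_operator = homogeneous_operator n \<gamma>
  for n :: nat and \<gamma> :: "'a::field operator2" +
  fixes a b c :: 'a
  assumes gen: "\<lbrakk>i \<in> {1..n}; j \<in> {1..n}\<rbrakk> \<Longrightarrow> [:-1, 1:] * gen_fun n \<gamma> i j
      = [:b, a:] * (monom 1 i - monom 1 j) + [:c:] * [:-1, 1:] * monom 1 j"
begin

abbreviation "A \<equiv> wt (emb a) (emb b)"

lemma ev2_basis_swap:
  assumes ij: "i \<in> {1..n}" "j \<in> {1..n}" and "x \<noteq> y" "y \<noteq> 0"
  shows "ev2 n (\<gamma> (unit_vec (i, j))) x y
       = A x y * (x ^ i * y ^ j) + (emb c - A x y) * (y ^ i * x ^ j)"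
proof -
  define t where "t = x / y"
  have t: "t - 1 \<noteq> 0" using assms by (simp add: t_def)
  \<comment> \<open>The difference of monomials is written as a sum because \<open>poly_at\<close> is rewritten by its rules for
    sums and products.\<close>
  have "poly_at ([:-1, 1:] * gen_fun n \<gamma> i j) t
      = poly_at ([:b, a:] * (monom 1 i + [:-1:] * monom 1 j) + [:c:] * [:-1, 1:] * monom 1 j) t"
    using gen[OF ij] by simp
  then have "(t - 1) * poly_at (gen_fun n \<gamma> i j) t
      = (emb a * t + emb b) * (t ^ i - t ^ j) + emb c * (t - 1) * t ^ j"
    unfolding poly_at_mult poly_at_add poly_at_monom poly_at_linear
    by (simp add: poly_at_pCons emb_def[symmetric] emb_minus)
  then have "poly_at (gen_fun n \<gamma> i j) t = A t 1 * (t ^ i - t ^ j) + emb c * t ^ j"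
    using t by (simp add: wt_def divide_simps) (simp add: algebra_simps)
  then have "ev2 n (\<gamma> (unit_vec (i, j))) x y
      = y ^ (i + j) * (A x y * (t ^ i - t ^ j) + emb c * t ^ j)"
    using ev2_basis[OF ij \<open>y \<noteq> 0\<close>] wt_quotient[OF \<open>y \<noteq> 0\<close>] by (simp add: t_def)
  moreover have "y ^ (i + j) * t ^ i = x ^ i * y ^ j" "y ^ (i + j) * t ^ j = y ^ i * x ^ j"
    using \<open>y \<noteq> 0\<close> by (simp_all add: t_def power_add power_divide)
  moreover have "y ^ (i + j) * (A x y * (t ^ i - t ^ j) + emb c * t ^ j)
      = A x y * (y ^ (i + j) * t ^ i) + (emb c - A x y) * (y ^ (i + j) * t ^ j)"
    by (simp add: algebra_simps)
  ultimately show ?thesis by simp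
qed

lemma ev2_swap:
  assumes "g \<in> tensor2 n" "x \<noteq> y" "y \<noteq> 0"
  shows "ev2 n (\<gamma> g) x y = A x y * ev2 n g x y + (emb c - A x y) * ev2 n g y x"
proof -
  let ?I = "{1..n} \<times> {1..n}"
  have "ev2 n (\<gamma> g) x y = (\<Sum>q\<in>?I. \<Sum>p\<in>?I.
      emb (g p) * (emb (\<gamma> (unit_vec p) q) * x ^ fst q * y ^ snd q))"
    using endo_on_expand[OF endo_coord, of g] assms(1)
    by (simp add: ev2_pairs tensor2_def emb_sum emb_mult sum_distrib_right mult.assoc)
  also have "\<dots> = (\<Sum>p\<in>?I. emb (g p) * ev2 n (\<gamma> (unit_vec p)) x y)"
    by (subst sum.swap) (simp add: ev2_pairs sum_distrib_left)
  also have "\<dots> = (\<Sum>p\<in>?I. emb (g p) * (A x y * (x ^ fst p * y ^ snd p)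
      + (emb c - A x y) * (y ^ fst p * x ^ snd p)))"
    using assms(2,3) by (intro sum.cong refl) (auto simp: ev2_basis_swap)
  also have "\<dots> = A x y * ev2 n g x y + (emb c - A x y) * ev2 n g y x"
    unfolding ev2_pairs sum_distrib_left sum.distrib[symmetric]
    by (intro sum.cong refl) (simp add: distrib_left mult_ac)
  finally show ?thesis .
qed

lemma ev3_op12:
  assumes "f \<in> tensor3 n" "x \<noteq> y" "y \<noteq> 0"
  shows "ev3 n (op12 \<gamma> f) x y z = A x y * ev3 n f x y z + (emb c - A x y) * ev3 n f y x z"
proof -
  have "(\<lambda>(i, j). f (i, j, k)) \<in> tensor2 n" for k
    using assms(1) by (auto simp: tensor3_def tensor2_def coord_space_def)
  then have "ev2 n (\<lambda>(i, j). op12 \<gamma> f (i, j, k)) x y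
      = A x y * ev2 n (\<lambda>(i, j). f (i, j, k)) x y
        + (emb c - A x y) * ev2 n (\<lambda>(i, j). f (i, j, k)) y x" for k
    using ev2_swap assms(2,3) by (simp add: op12_def)
  then show ?thesis
    by (simp add: ev3_slice_last sum_distrib_left sum.distrib[symmetric] distrib_right mult.assoc)
qed

lemma ev3_op23:
  assumes "f \<in> tensor3 n" "y \<noteq> z" "z \<noteq> 0"
  shows "ev3 n (op23 \<gamma> f) x y z = A y z * ev3 n f x y z + (emb c - A y z) * ev3 n f x z y"
proof -
  have "(\<lambda>(j, k). f (i, j, k)) \<in> tensor2 n" for i
    using assms(1) by (auto simp: tensor3_def tensor2_def coord_space_def)
  then have "ev2 n (\<lambda>(j, k). op23 \<gamma> f (i, j, k)) y z
      = A y z * ev2 n (\<lambda>(j, k). f (i, j, k)) y z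
        + (emb c - A y z) * ev2 n (\<lambda>(j, k). f (i, j, k)) z y" for i
    using ev2_swap assms(2,3) by (simp add: op23_def)
  then show ?thesis
    by (simp add: ev3_slice_first sum_distrib_left sum.distrib[symmetric] distrib_left
        mult.left_commute)
qed

text \<open>
  Both sides are tensors, so it is enough to compare them at the Kronecker point, where \<open>op12\<close> and
  \<open>op23\<close> act as the twisted swaps of \<open>twisted_braid_defect\<close>.
\<close>

lemma braid_defect:
  assumes f: "f \<in> tensor3 n" and "n > 0"
  shows "op12 \<gamma> (op23 \<gamma> (op12 \<gamma> f)) t - op23 \<gamma> (op12 \<gamma> (op23 \<gamma> f)) t
       = - (a * b) * (op12 \<gamma> f t - op23 \<gamma> f t)"
proof -
  define D where "D = (\<lambda>t. op12 \<gamma> (op23 \<gamma> (op12 \<gamma> f)) t - op23 \<gamma> (op12 \<gamma> (op23 \<gamma> f)) t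
      - (- (a * b)) * (op12 \<gamma> f t - op23 \<gamma> f t))"
  note mem = op12_tensor3 op23_tensor3 f
  have D: "D \<in> tensor3 n"
    using mem(1)[OF mem(2)[OF mem(1)[OF f]]] mem(2)[OF mem(1)[OF mem(2)[OF f]]]
      mem(1)[OF f] mem(2)[OF f]
    by (simp add: D_def tensor3_def coord_space_def)
  define x y z :: "'a poly poly fract" where "x = bivX" and "y = bivY" and "z = bivY ^ Suc n"
  have ne: "x \<noteq> y" "x \<noteq> z" "y \<noteq> z" "y \<noteq> x" "z \<noteq> x" "z \<noteq> y" "x \<noteq> 0" "y \<noteq> 0" "z \<noteq> 0"
    using kronecker_point[OF \<open>n > 0\<close>, where 'a = 'a] unfolding x_def y_def z_def by metis+
  have scale: "ev3 n (\<lambda>t. d * g t) x y z = emb d * ev3 n g x y z" for d g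
    by (simp add: ev3_def emb_mult sum_distrib_left mult_ac)
  have "ev3 n D x y z = ev3 n (op12 \<gamma> (op23 \<gamma> (op12 \<gamma> f))) x y z
      - ev3 n (op23 \<gamma> (op12 \<gamma> (op23 \<gamma> f))) x y z
      - (- (emb a * emb b)) * (ev3 n (op12 \<gamma> f) x y z - ev3 n (op23 \<gamma> f) x y z)"
    by (simp only: D_def ev3_diff scale emb_minus emb_mult)
  also have "\<dots> = 0"
    using twisted_braid_defect[OF ne(1-3), where a = "emb a" and b = "emb b"
        and c = "emb c" and h = "ev3 n f"]
    by (simp add: ev3_op12 ev3_op23 mem ne)
  finally have "D t = 0"
    using ev3_kronecker_eq_0[OF D] by (simp add: x_def y_def z_def)
  then show ?thesis unfolding D_def by (simp only: right_minus_eq)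
qed

text \<open>
  For these parameters \<open>A(x, y)\<close> is the constant \<open>c\<close>, so the swaps disappear and both operators multiply
  by \<open>c\<close>.
\<close>

lemma op12_eq_op23:
  assumes f: "f \<in> tensor3 n" and "n > 0" and "a = c" "b = - c"
  shows "op12 \<gamma> f = op23 \<gamma> f"
proof
  fix t
  have wt: "A x y = emb c" if "x \<noteq> y" for x y :: "'a poly poly fract"
  proof -
    have "x - y \<noteq> 0" using that by simp
    then show ?thesis by (simp add: wt_def assms(3,4) emb_minus field_simps)
  qed
  have mem: "(\<lambda>t. op12 \<gamma> f t - op23 \<gamma> f t) \<in> tensor3 n"
    using op12_tensor3[OF f] op23_tensor3[OF f] by (simp add: tensor3_def coord_space_def)
  have "ev3 n (\<lambda>t. op12 \<gamma> f t - op23 \<gamma> f t) bivX bivY (bivY ^ Suc n) = 0"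
    unfolding ev3_diff using kronecker_point[OF \<open>n > 0\<close>, where 'a = 'a]
    by (simp add: ev3_op12[OF f] ev3_op23[OF f] wt del: power_Suc)
  from ev3_kronecker_eq_0[OF mem this] show "op12 \<gamma> f t = op23 \<gamma> f t" by simp
qed

end

section \<open>The rational functions and the theorem\<close>

lemma subst_rat_wt:
  assumes "t \<noteq> 1"
  shows "subst_rat (to_fract [:b, a:] / to_fract [:-1, 1:]) t = wt (emb a) (emb b) t 1"
proof -
  have "poly_at [:-1, 1:] t = t - 1" for t :: "'a poly poly fract"
    by (simp add: poly_at_linear emb_minus)
  then show ?thesis
    using assms by (simp add: subst_rat_eq poly_at_linear wt_def)
qed

text \<open>
  \<open>G_{11} = (\<alpha> + \<beta>) x\<close> is a multiple of \<open>x\<close>, which gives \<open>\<alpha> + \<beta> = c\<close>. Then \<open>G_{21} / x = \<alpha> x + \<beta>\<close> is a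
  polynomial of degree at most \<open>1\<close>, and subtracting the first relation leaves \<open>\<alpha> (x - 1)\<close>.
  The scalars are matrix entries of \<open>\<gamma>\<close>: \<open>a\<close> and \<open>b + c\<close> are the coefficients of \<open>e_2 \<otimes> e_1\<close> and
  \<open>e_1 \<otimes> e_2\<close> in \<open>\<gamma> (e_2 \<otimes> e_1)\<close>.
\<close>

lemma generating_function_shape:
  fixes \<alpha> \<beta> :: "'a::field poly fract"
  assumes "n \<ge> 2" "homogeneous_operator n \<gamma>"
    and gen: "\<And>i j. i \<in> {1..n} \<Longrightarrow> j \<in> {1..n} \<Longrightarrow>
           to_fract (gen_fun n \<gamma> i j) = \<alpha> * ratX ^ i + \<beta> * ratX ^ j"
  defines "a \<equiv> hom_coeff \<gamma> 2 1 2" and "c \<equiv> hom_coeff \<gamma> 1 1 1"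
  defines "b \<equiv> hom_coeff \<gamma> 2 1 1 - c"
  shows "\<alpha> = to_fract [:b, a:] / to_fract [:-1, 1:]"
    and "\<beta> = to_fract [:- (c + b), c - a:] / to_fract [:-1, 1:]"
proof -
  interpret homogeneous_operator n \<gamma> by fact
  have "gen_fun n \<gamma> 1 1 = (\<Sum>k\<in>{1}. monom (hom_coeff \<gamma> 1 1 k) k)"
    unfolding gen_fun_def using \<open>n \<ge> 2\<close>
    by (intro sum.mono_neutral_right) (auto simp: hom_coeff_eq_0)
  then have G11: "gen_fun n \<gamma> 1 1 = [:c:] * [:0, 1:]"
    by (simp add: c_def monom_Suc monom_0)
  have "gen_fun n \<gamma> 2 1 = (\<Sum>k\<in>{1, 2}. monom (hom_coeff \<gamma> 2 1 k) k)"
    unfolding gen_fun_def using \<open>n \<ge> 2\<close>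
    by (intro sum.mono_neutral_right) (auto simp: hom_coeff_eq_0)
  then have G21: "gen_fun n \<gamma> 2 1 = ([:b, a:] + [:c:]) * [:0, 1:]"
    by (simp add: a_def b_def monom_Suc monom_0 numeral_2_eq_2)
  have X: "ratX \<noteq> (0 :: 'a poly fract)" by (simp add: ratX_def)
  have X1: "to_fract [:-1, 1:] = ratX - (1 :: 'a poly fract)"
    by (simp add: ratX_def one_pCons flip: to_fract_diff to_fract_1)
  have "\<alpha> * ratX + \<beta> * ratX = to_fract [:c:] * ratX"
    using gen[of 1 1] \<open>n \<ge> 2\<close> G11 by (simp add: ratX_def flip: to_fract_mult)
  then have sum: "\<alpha> + \<beta> = to_fract [:c:]"
    using X by (simp flip: distrib_right)
  have "(\<alpha> * ratX + \<beta>) * ratX = (to_fract [:b, a:] + to_fract [:c:]) * ratX"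
    using gen[of 2 1] \<open>n \<ge> 2\<close> G21
    by (simp add: ratX_def power2_eq_square algebra_simps flip: to_fract_mult to_fract_add)
  then have "\<alpha> * ratX + \<beta> = to_fract [:b, a:] + to_fract [:c:]"
    using X by simp
  moreover have "\<alpha> * (ratX - 1) = (\<alpha> * ratX + \<beta>) - (\<alpha> + \<beta>)"
    by (simp add: algebra_simps)
  ultimately have \<alpha>: "\<alpha> * (ratX - 1) = to_fract [:b, a:]"
    using sum by simp
  have ne: "ratX - 1 \<noteq> (0 :: 'a poly fract)"
    unfolding X1[symmetric] by simp
  show "\<alpha> = to_fract [:b, a:] / to_fract [:-1, 1:]"
    using \<alpha> ne unfolding X1 by (simp add: field_simps)
  have "\<beta> * (ratX - 1) = to_fract [:c:] * to_fract [:-1, 1:] - to_fract [:b, a:]"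
    unfolding X1 \<alpha>[symmetric] sum[symmetric] by (simp add: algebra_simps)
  also have "\<dots> = to_fract [:- (c + b), c - a:]"
    by (simp add: algebra_simps flip: to_fract_mult to_fract_diff)
  finally show "\<beta> = to_fract [:- (c + b), c - a:] / to_fract [:-1, 1:]"
    using ne unfolding X1 by (simp add: field_simps)
qed

theorem theorem2p2:
  fixes n :: nat
    and \<gamma> :: "(nat \<times> nat \<Rightarrow> 'a::field) \<Rightarrow> (nat \<times> nat \<Rightarrow> 'a)"
    and \<alpha> \<beta> :: "'a poly fract"
  assumes "n \<ge> 2"
    and "endo_on (tensor2 n) \<gamma>"
    and "homogeneous n \<gamma>"
    and "\<And>i j. i \<in> {1..n} \<Longrightarrow> j \<in> {1..n} \<Longrightarrow>
           to_fract (gen_fun n \<gamma> i j) = \<alpha> * ratX ^ i + \<beta> * ratX ^ j"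
  shows "yang_baxter n \<gamma> \<longleftrightarrow>
    \<beta> = 0 \<or>
    (subst_rat \<alpha> bivX * subst_rat \<alpha> bivY =
       subst_rat \<alpha> (bivX / bivY) * subst_rat \<alpha> bivY + subst_rat \<alpha> bivX * subst_rat \<alpha> (bivY / bivX) \<and>
     (subst_rat \<alpha> (bivX / bivY))\<^sup>2 * subst_rat \<alpha> bivY +
         subst_rat \<beta> (bivX / bivY) * subst_rat \<alpha> bivX * subst_rat \<beta> (bivY / bivX) =
       (subst_rat \<alpha> bivY)\<^sup>2 * subst_rat \<alpha> (bivX / bivY) +
         subst_rat \<beta> bivY * subst_rat \<alpha> bivX * subst_rat \<beta> (1 / bivY))"
proof -
  interpret homogeneous_operator n \<gamma> by unfold_locales (fact assms)+
  define a c where "a = hom_coeff \<gamma> 2 1 2" and "c = hom_coeff \<gamma> 1 1 1"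
  define b where "b = hom_coeff \<gamma> 2 1 1 - c"
  have \<alpha>: "\<alpha> = to_fract [:b, a:] / to_fract [:-1, 1:]"
    and \<beta>: "\<beta> = to_fract [:- (c + b), c - a:] / to_fract [:-1, 1:]"
    unfolding a_def b_def c_def
    using generating_function_shape[OF assms(1) homogeneous_operator_axioms assms(4)] by simp_all
  have X1: "to_fract [:-1, 1:] \<noteq> (0 :: 'a poly fract)" by simp
  interpret rational_operator n \<gamma> a b c
  proof
    fix i j assume "i \<in> {1..n}" "j \<in> {1..n}"
    have pow: "ratX ^ k = to_fract (monom (1 :: 'a) k)" for k
      by (induction k) (simp_all add: ratX_def monom_Suc monom_0 flip: one_pCons to_fract_mult)
    have "to_fract ([:-1, 1:] * gen_fun n \<gamma> i j)
        = to_fract [:b, a:] * to_fract (monom 1 i)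
          + to_fract [:- (c + b), c - a:] * to_fract (monom 1 j)"
      using assms(4)[OF \<open>i \<in> {1..n}\<close> \<open>j \<in> {1..n}\<close>] X1
      unfolding to_fract_mult pow \<alpha> \<beta> by (simp add: field_simps)
    also have "\<dots> = to_fract ([:b, a:] * monom 1 i + [:- (c + b), c - a:] * monom 1 j)"
      by (simp only: to_fract_add to_fract_mult)
    also have "[:- (c + b), c - a:] = [:c:] * [:-1, 1:] - [:b, a:]"
      by simp
    finally show "[:-1, 1:] * gen_fun n \<gamma> i j
        = [:b, a:] * (monom 1 i - monom 1 j) + [:c:] * [:-1, 1:] * monom 1 j"
      unfolding to_fract_eq_iff by (simp only: algebra_simps)
  qed
  have \<beta>_eq_0: "\<beta> = 0 \<longleftrightarrow> c = a \<and> b = - c"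
    using X1 by (auto simp: \<beta> add_eq_0_iff)
  have "yang_baxter n \<gamma> \<longleftrightarrow> \<beta> = 0 \<or> a * b = 0"
  proof
    assume yb: "yang_baxter n \<gamma>"
    have "c = a \<and> b = - c" if "a * b \<noteq> 0"
    proof -
      \<comment> \<open>By the defect formula, \<open>\<gamma> \<otimes> 1\<close> and \<open>1 \<otimes> \<gamma>\<close> coincide. On \<open>e_2 \<otimes> e_1 \<otimes> e_1\<close> the second gives
        \<open>c\<close> times this vector, the first adds \<open>b + c\<close> times \<open>e_1 \<otimes> e_2 \<otimes> e_1\<close> to \<open>a\<close> times it.\<close>
      let ?e = "unit_vec (2, 1, 1) :: nat \<times> nat \<times> nat \<Rightarrow> 'a"
      have "?e \<in> tensor3 n"
        using \<open>n \<ge> 2\<close> by (auto simp: tensor3_def coord_space_def unit_vec_def)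
      then have eq: "op12 \<gamma> ?e t = op23 \<gamma> ?e t" for t
        using yb braid_defect[of ?e t] that \<open>n \<ge> 2\<close> by (simp add: yang_baxter_def)
      have slice12: "(\<lambda>(i, j). ?e (i, j, 1)) = unit_vec (2, 1)"
        by (auto simp: unit_vec_def)
      have slice23: "(\<lambda>(j, k). ?e (i, j, k)) = (if i = 2 then unit_vec (1, 1) else (\<lambda>_. 0))" for i
        by (auto simp: unit_vec_def)
      have "a = c"
        using eq[of "(2, 1, 1)"] unfolding op12_def op23_def
        by (simp add: slice12[simplified] slice23[simplified] a_def c_def hom_coeff_def matrix_coeff_def)
      moreover have "b + c = 0"
        using eq[of "(1, 2, 1)"] endo_on_zero[OF endo_coord] unfolding op12_def op23_def
        by (simp add: slice12[simplified] slice23[simplified] b_def hom_coeff_def matrix_coeff_def)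
      ultimately show ?thesis by (simp add: add_eq_0_iff2)
    qed
    then show "\<beta> = 0 \<or> a * b = 0" by (auto simp: \<beta>_eq_0)
  next
    assume "\<beta> = 0 \<or> a * b = 0"
    then show "yang_baxter n \<gamma>"
    proof
      assume "a * b = 0"
      then show ?thesis
        using braid_defect \<open>n \<ge> 2\<close> by (auto simp: yang_baxter_def fun_eq_iff)
    next
      assume "\<beta> = 0"
      then have "a = c" "b = - c" by (simp_all add: \<beta>_eq_0)
      show ?thesis
        unfolding yang_baxter_def
      proof (intro ballI ext)
        fix f :: "nat \<times> nat \<times> nat \<Rightarrow> 'a" and t
        assume f: "f \<in> tensor3 n"
        have "op12 \<gamma> f t - op23 \<gamma> f t = 0"
          using op12_eq_op23[OF f] \<open>n \<ge> 2\<close> \<open>a = c\<close> \<open>b = - c\<close> by simp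
        with braid_defect[OF f, of t] \<open>n \<ge> 2\<close>
        show "op12 \<gamma> (op23 \<gamma> (op12 \<gamma> f)) t = op23 \<gamma> (op12 \<gamma> (op23 \<gamma> f)) t"
          by (simp only: mult_zero_right right_minus_eq)
      qed
    qed
  qed
  also have "(a * b = 0) =
    (subst_rat \<alpha> bivX * subst_rat \<alpha> bivY =
       subst_rat \<alpha> (bivX / bivY) * subst_rat \<alpha> bivY + subst_rat \<alpha> bivX * subst_rat \<alpha> (bivY / bivX) \<and>
     (subst_rat \<alpha> (bivX / bivY))\<^sup>2 * subst_rat \<alpha> bivY +
         subst_rat \<beta> (bivX / bivY) * subst_rat \<alpha> bivX * subst_rat \<beta> (bivY / bivX) =
       (subst_rat \<alpha> bivY)\<^sup>2 * subst_rat \<alpha> (bivX / bivY) +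
         subst_rat \<beta> bivY * subst_rat \<alpha> bivX * subst_rat \<beta> (1 / bivY))"
  proof -
    define x y :: "'a poly poly fract" where "x = bivX" and "y = bivY"
    have ne: "x \<noteq> 0" "y \<noteq> 0" "x \<noteq> 1" "y \<noteq> 1" "x \<noteq> y"
      using biv_distinct bivX_neq_bivY_power[of 1] by (auto simp: x_def y_def)
    have \<alpha>_at: "subst_rat \<alpha> t = A t 1" if "t \<noteq> 1" for t
      using that by (simp add: \<alpha> subst_rat_wt)
    have \<beta>_at: "subst_rat \<beta> t = emb c - A t 1" if "t \<noteq> 1" for t
      using that by (simp add: \<beta> subst_rat_wt wt_def emb_diff emb_minus emb_add field_simps)
    have at: "subst_rat \<alpha> x = A x 1" "subst_rat \<alpha> y = A y 1"
      "subst_rat \<alpha> (x / y) = A x y" "subst_rat \<alpha> (y / x) = A y x"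
      "subst_rat \<beta> y = emb c - A y 1" "subst_rat \<beta> (1 / y) = emb c - A 1 y"
      "subst_rat \<beta> (x / y) = emb c - A x y" "subst_rat \<beta> (y / x) = emb c - A y x"
      using ne by (simp_all add: \<alpha>_at \<beta>_at wt_quotient)
    have "emb a * emb b = 0 \<longleftrightarrow> A x 1 * A y 1 = A x y * A y 1 + A x 1 * A y x"
      using wt_cocycle[of x y 1 "emb a" "emb b"] ne by (auto simp: mult.commute)
    moreover have "(A x y)\<^sup>2 * A y 1 + (emb c - A x y) * A x 1 * (emb c - A y x)
        = (A y 1)\<^sup>2 * A x y + (emb c - A y 1) * A x 1 * (emb c - A 1 y)" if "emb a * emb b = 0"
      using wt_second_identity[of x y 1 "emb a" "emb b" "emb c"] ne that by simp
    ultimately show ?thesis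
      unfolding x_def[symmetric] y_def[symmetric] at
      by (metis emb_eq_0_iff mult_eq_0_iff)
  qed
  finally show ?thesis .
qed

end
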